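(* Let $k$ be a positive integer, let $p \in [\tfrac{2}{3},1)$, and let $n$ be an integer with $n \geq \max\left(4k^2 - 4k + 3,\ \frac{1}{1-p}(k^2-1) + 2\right)$. Let $H$ be a complete multipartite subgraph of the complement of $\mathrm{Kneser}(n,k)$ such that no colour class (part) of $H$ contains more than $p|H|$ vertices. Then $|H| \leq \binom{n-1}{k-1}$.
   Context: The Kneser graph $\mathrm{Kneser}(n,k)$ has as vertex set the family of all $k$-element subsets of $[n]=\{1,\dots,n\}$, two vertices adjacent iff they are disjoint; its complement therefore has two $k$-sets adjacent iff they intersect. A complete multipartite subgraph $H$ of a graph is a subgraph whose vertex set is partitioned into colour classes (parts) such that any two vertices in different classes are adjacent in $H$. $|H|$ denotes the number of vertices of $H$. *)

theory Defs
  imports Complex_Main "HOL-Library.Disjoint_Sets" "Graph_Theory.Graph_Theory"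
begin

text \<open>
  Simple graphs are the symmetric loop-free digraphs given by the locale \<^locale>\<open>pair_graph\<close>;
  every edge is present as two opposite arcs.
\<close>

definition kneser_graph :: "nat \<Rightarrow> nat \<Rightarrow> nat set pair_pre_digraph" where
  "kneser_graph n k =
     \<lparr> pverts = {A. A \<subseteq> {1..n} \<and> card A = k},
       parcs = {(A, B). A \<subseteq> {1..n} \<and> card A = k \<and> B \<subseteq> {1..n} \<and> card B = k
                         \<and> A \<noteq> B \<and> A \<inter> B = {}} \<rparr>"
  \<comment> \<open>\<open>A \<noteq> B\<close> is redundant for \<open>k > 0\<close>; it only avoids a loop at the empty set when \<open>k = 0\<close>.\<close>

definition graph_complement :: "'a pair_pre_digraph \<Rightarrow> 'a pair_pre_digraph" where
  "graph_complement G =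
     \<lparr> pverts = pverts G,
       parcs = {(u, v). u \<in> pverts G \<and> v \<in> pverts G \<and> u \<noteq> v \<and> (u, v) \<notin> parcs G} \<rparr>"

text \<open>
  \<open>complete_multipartite H P\<close>: the graph \<open>H\<close> is complete multipartite with set of (nonempty) colour
  classes \<open>P\<close>. Only adjacency between different classes is demanded. Edges inside a class are not
  excluded, so the case where each class is independent in \<open>H\<close> is included. Deleting all edges
  inside classes changes neither the vertices nor the classes.
\<close>

definition complete_multipartite :: "'a pair_pre_digraph \<Rightarrow> 'a set set \<Rightarrow> bool" where
  "complete_multipartite H P \<longleftrightarrow>
     pair_graph H \<and> partition_on (pverts H) P \<and>
     (\<forall>A\<in>P. \<forall>B\<in>P. A \<noteq> B \<longrightarrow> (\<forall>u\<in>A. \<forall>v\<in>B. (u, v) \<in> parcs H))"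

lemma finite_pverts_kneser_graph: "finite (pverts (kneser_graph n k))"
  by (rule finite_subset[of _ "Pow {1..n}"]) (auto simp: kneser_graph_def)

lemma pair_graph_kneser_graph: "pair_graph (kneser_graph n k)"
proof
  show "finite (parcs (kneser_graph n k))"
    by (rule finite_subset[of _ "pverts (kneser_graph n k) \<times> pverts (kneser_graph n k)"])
      (use finite_pverts_kneser_graph in \<open>auto simp: kneser_graph_def\<close>)
  show "symmetric (kneser_graph n k)"
    by (auto simp: symmetric_def kneser_graph_def intro!: symI)
qed (auto simp: finite_pverts_kneser_graph, auto simp: kneser_graph_def)

lemma pair_graph_graph_complement:
  assumes "pair_graph G"
  shows "pair_graph (graph_complement G)"
proof -
  interpret pair_graph G by (fact assms)
  show ?thesis
  proof
    show "finite (parcs (graph_complement G))"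
      by (rule finite_subset[of _ "pverts G \<times> pverts G"])
        (use pair_finite_verts in \<open>auto simp: graph_complement_def\<close>)
    show "symmetric (graph_complement G)"
      using pair_sym_arcs by (auto simp: symmetric_def graph_complement_def sym_def)
  qed (use pair_finite_verts in \<open>auto simp: graph_complement_def\<close>)
qed

lemma parcs_graph_complement_kneser_graph:
  "(A, B) \<in> parcs (graph_complement (kneser_graph n k)) \<longleftrightarrow>
     A \<subseteq> {1..n} \<and> card A = k \<and> B \<subseteq> {1..n} \<and> card B = k \<and> A \<noteq> B \<and> A \<inter> B \<noteq> {}"
  by (auto simp: graph_complement_def kneser_graph_def)

end

theory Submission
  imports Defs
begin

text \<open>
  Grouping colour classes gives two disjoint cross-intersecting families \<open>A\<close> and \<open>B\<close> covering
  the vertices of \<open>H\<close>, neither with more than a fraction \<open>p\<close> of them; say \<open>|A| \<ge> |B|\<close>. Put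
  \<open>D = (n - 2 choose k - 2)\<close>. If \<open>|H| > (n - 1 choose k - 1)\<close>, the bounds on \<open>n\<close> give
  \<open>|B| > k D\<close> and \<open>(k - 1) |A| > (2 k (k - 1) + 1) D\<close>. No element \<open>x\<close> lies in all members of \<open>B\<close>:
  otherwise either \<open>x\<close> lies in every vertex of \<open>H\<close>, or some member of \<open>A\<close> avoids \<open>x\<close> and
  \<open>|B| \<le> k D\<close>. Hence every element lies in at most \<open>k D\<close> members of \<open>A\<close>. A fixed member of \<open>A\<close>
  meets all of \<open>B\<close>, so some \<open>x\<close> lies in more than \<open>D\<close> members of \<open>B\<close>. The link of \<open>x\<close> in \<open>B\<close>
  and the members of \<open>A\<close> avoiding \<open>x\<close> are then cross-intersecting families on \<open>n - 1\<close> points which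
  are both too large; this last step is a Kruskal-Katona type bound, proved by shifting.
\<close>

subsection \<open>Shifting cross-intersecting families\<close>

definition cross_intersecting :: "'a set set \<Rightarrow> 'a set set \<Rightarrow> bool" where
  "cross_intersecting U V \<longleftrightarrow> (\<forall>u\<in>U. \<forall>v\<in>V. u \<inter> v \<noteq> {})"

abbreviation k_subsets :: "'a set \<Rightarrow> nat \<Rightarrow> 'a set set" where
  "k_subsets X k \<equiv> {u. u \<subseteq> X \<and> card u = k}"

text \<open>The compression of Erdos, Ko and Rado. The test against \<open>F\<close> keeps a set in
  place when its target is already taken, which makes the map injective on \<open>F\<close>.\<close>

definition shift_set :: "nat \<Rightarrow> nat \<Rightarrow> nat set set \<Rightarrow> nat set \<Rightarrow> nat set" where
  "shift_set i j F u =
     (if j \<in> u \<and> i \<notin> u \<and> insert i (u - {j}) \<notin> F then insert i (u - {j}) else u)"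

definition shifted :: "nat set set \<Rightarrow> bool" where
  "shifted F \<longleftrightarrow> (\<forall>u\<in>F. \<forall>j\<in>u. \<forall>i<j. i \<notin> u \<longrightarrow> insert i (u - {j}) \<in> F)"

lemma finite_k_subsets: "finite X \<Longrightarrow> finite (k_subsets X k)"
  by (rule finite_subset[of _ "Pow X"]) auto

lemma card_insert_Diff_singleton:
  assumes "finite A" "j \<in> A" "i \<notin> A"
  shows "card (insert i (A - {j})) = card A"
  using assms by (metis Diff_iff card_insert_disjoint card_Suc_Diff1 finite_Diff)

text \<open>A moved set lands outside \<open>F\<close>, so it cannot coincide with one that stays;
  two moved sets are recovered by undoing the exchange.\<close>

lemma inj_on_shift_set: "inj_on (shift_set i j F) F"
proof (rule inj_onI)
  fix u v assume uv: "u \<in> F" "v \<in> F" "shift_set i j F u = shift_set i j F v"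
  have eq: "insert j (insert i (w - {j}) - {i}) = w" if "j \<in> w" "i \<notin> w" for w :: "nat set"
    using that by auto
  show "u = v"
  proof (cases "shift_set i j F u = u \<or> shift_set i j F v = v")
    case True
    then show ?thesis using uv by (metis shift_set_def)
  next
    case False
    then show ?thesis using uv eq by (metis shift_set_def)
  qed
qed

lemma shift_set_in_k_subsets:
  assumes "F \<subseteq> k_subsets {..<m} k" "i < j"
  shows "shift_set i j F ` F \<subseteq> k_subsets {..<m} k"
proof
  fix w assume "w \<in> shift_set i j F ` F"
  then obtain u where u: "u \<in> F" "w = shift_set i j F u" by auto
  have "u \<subseteq> {..<m}" "card u = k" using u assms by auto
  then have "finite u" by (meson finite_lessThan finite_subset)
  show "w \<in> k_subsets {..<m} k"
  proof (cases "w = u")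
    case True
    then show ?thesis using \<open>u \<subseteq> {..<m}\<close> \<open>card u = k\<close> by auto
  next
    case False
    then have w: "w = insert i (u - {j})" "j \<in> u" "i \<notin> u"
      using u by (auto simp: shift_set_def split: if_splits)
    have "card w = k"
      using card_insert_Diff_singleton[OF \<open>finite u\<close> w(2,3)] w(1) \<open>card u = k\<close> by simp
    moreover have "w \<subseteq> {..<m}"
      using w \<open>u \<subseteq> {..<m}\<close> \<open>i < j\<close> by auto
    ultimately show ?thesis by auto
  qed
qed

text \<open>If both sets move, both contain \<open>i\<close>. Suppose only \<open>a\<close> moves.
  If \<open>b\<close> stays because its target is occupied, then \<open>a\<close> meets that target
  in a point other than \<open>i\<close> and \<open>j\<close>, which survives the move. If
  \<open>b\<close> stays because it lacks \<open>j\<close> or contains \<open>i\<close>, an old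
  common point survives or \<open>i\<close> becomes one.\<close>

lemma cross_intersecting_shift_set:
  assumes "cross_intersecting U V"
  shows "cross_intersecting (shift_set i j U ` U) (shift_set i j V ` V)"
proof -
  have one: "shift_set i j X a \<inter> shift_set i j Y b \<noteq> {}"
    if "cross_intersecting X Y" "a \<in> X" "b \<in> Y" "shift_set i j Y b = b" for X Y a b
  proof (cases "shift_set i j X a = a")
    case True
    then show ?thesis using that by (auto simp: cross_intersecting_def)
  next
    case False
    then have a: "shift_set i j X a = insert i (a - {j})" "j \<in> a" "i \<notin> a"
      by (auto simp: shift_set_def split: if_splits)
    have "(insert i (a - {j})) \<inter> b \<noteq> {}"
    proof (cases "j \<in> b \<and> i \<notin> b")
      case True
      then have "insert i (b - {j}) \<in> Y"
        using \<open>shift_set i j Y b = b\<close> by (auto simp: shift_set_def split: if_splits)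
      then have "a \<inter> insert i (b - {j}) \<noteq> {}"
        using that unfolding cross_intersecting_def by blast
      then show ?thesis using a by auto
    next
      case False
      moreover have "a \<inter> b \<noteq> {}" using that by (auto simp: cross_intersecting_def)
      ultimately show ?thesis using a by auto
    qed
    then show ?thesis using a that by simp
  qed
  have "shift_set i j U a \<inter> shift_set i j V b \<noteq> {}" if ab: "a \<in> U" "b \<in> V" for a b
  proof -
    have "shift_set i j F c = c \<or> i \<in> shift_set i j F c" for F c
      by (simp add: shift_set_def)
    then consider "shift_set i j V b = b" | "shift_set i j U a = a"
      | "i \<in> shift_set i j U a" "i \<in> shift_set i j V b"
      by blast
    then show ?thesis
    proof cases
      case 1 then show ?thesis using one assms ab by metis
    next
      case 2
      have "cross_intersecting V U" using assms by (auto simp: cross_intersecting_def)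
      then show ?thesis using one[of V U b a] 2 ab by (metis inf_commute)
    qed auto
  qed
  then show ?thesis by (auto simp: cross_intersecting_def)
qed

text \<open>The total element sum is the potential that leads to shifted families: by injectivity it
  can be compared set by set, and every set that moves lowers it by \<open>j - i\<close>.\<close>

lemma sum_shift_set_le:
  assumes "finite F" "\<And>u. u \<in> F \<Longrightarrow> finite u" "i < j"
  shows "(\<Sum>u\<in>shift_set i j F ` F. \<Sum>u) \<le> (\<Sum>u\<in>F. \<Sum>u)"
    and "u \<in> F \<Longrightarrow> shift_set i j F u \<noteq> u \<Longrightarrow>
           (\<Sum>u\<in>shift_set i j F ` F. \<Sum>u) < (\<Sum>u\<in>F. \<Sum>u)"
proof -
  have reindex: "(\<Sum>u\<in>shift_set i j F ` F. \<Sum>u) = (\<Sum>u\<in>F. \<Sum>(shift_set i j F u))"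
    by (simp add: sum.reindex[OF inj_on_shift_set])
  have less: "\<Sum>(shift_set i j F u) < \<Sum>u" if "u \<in> F" "shift_set i j F u \<noteq> u" for u
  proof -
    have "shift_set i j F u = insert i (u - {j})" "j \<in> u" "i \<notin> u"
      using that by (auto simp: shift_set_def split: if_splits)
    moreover have "\<Sum>u = j + \<Sum>(u - {j})"
      using \<open>j \<in> u\<close> assms(2) that by (simp add: sum.remove)
    ultimately show ?thesis using assms(2,3) that by simp
  qed
  have le: "\<Sum>(shift_set i j F u) \<le> \<Sum>u" if "u \<in> F" for u
    using less[OF that] by (cases "shift_set i j F u = u") auto
  show "(\<Sum>u\<in>shift_set i j F ` F. \<Sum>u) \<le> (\<Sum>u\<in>F. \<Sum>u)"
    unfolding reindex by (intro sum_mono le)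
  show "(\<Sum>u\<in>shift_set i j F ` F. \<Sum>u) < (\<Sum>u\<in>F. \<Sum>u)" if "u \<in> F" "shift_set i j F u \<noteq> u"
    unfolding reindex by (rule sum_strict_mono_ex1) (use assms(1) le less that in auto)
qed

lemma ex_shifted_cross_intersecting:
  assumes "U \<subseteq> k_subsets {..<m} k" "V \<subseteq> k_subsets {..<m} l" "cross_intersecting U V"
  obtains U' V' where "U' \<subseteq> k_subsets {..<m} k" "V' \<subseteq> k_subsets {..<m} l"
    "cross_intersecting U' V'" "card U' = card U" "card V' = card V" "shifted U'" "shifted V'"
proof -
  \<comment> \<open>A pair of least total element sum is fixed by every shift.\<close>
  define Q where "Q = (\<lambda>(U', V'). U' \<subseteq> k_subsets {..<m} k \<and> V' \<subseteq> k_subsets {..<m} l \<and>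
    cross_intersecting U' V' \<and> card U' = card U \<and> card V' = card V)"
  define w where "w = (\<lambda>(U', V'). (\<Sum>u\<in>U'. \<Sum>u) + (\<Sum>v\<in>V'. \<Sum>v :: nat))"
  have "Q (U, V)" using assms by (auto simp: Q_def)
  from ex_has_least_nat[of Q, OF this, of w] obtain U' V' where Q: "Q (U', V')"
    and least: "\<And>X Y. Q (X, Y) \<Longrightarrow> w (U', V') \<le> w (X, Y)"
    by fastforce
  have UV: "U' \<subseteq> k_subsets {..<m} k" "V' \<subseteq> k_subsets {..<m} l"
    "cross_intersecting U' V'" "card U' = card U" "card V' = card V"
    using Q by (auto simp: Q_def)
  have fin: "finite U'" "finite V'" "\<And>u. u \<in> U' \<Longrightarrow> finite u" "\<And>u. u \<in> V' \<Longrightarrow> finite u"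
    using finite_subset[OF UV(1) finite_k_subsets] finite_subset[OF UV(2) finite_k_subsets]
      finite_subset[OF _ finite_lessThan[of m]] UV(1,2) by auto
  have stable: "(\<forall>u\<in>U'. shift_set i j U' u = u) \<and> (\<forall>v\<in>V'. shift_set i j V' v = v)"
    if "i < j" for i j
  proof (rule ccontr)
    assume moved: "\<not> ?thesis"
    have "Q (shift_set i j U' ` U', shift_set i j V' ` V')"
      using UV shift_set_in_k_subsets[OF UV(1) \<open>i < j\<close>] shift_set_in_k_subsets[OF UV(2) \<open>i < j\<close>]
        cross_intersecting_shift_set[OF UV(3)]
      unfolding Q_def by (simp add: card_image[OF inj_on_shift_set])
    then have le: "w (U', V') \<le> w (shift_set i j U' ` U', shift_set i j V' ` V')" by (rule least)
    have "(\<Sum>u\<in>shift_set i j U' ` U'. \<Sum>u) < (\<Sum>u\<in>U'. \<Sum>u) \<or>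
          (\<Sum>v\<in>shift_set i j V' ` V'. \<Sum>v) < (\<Sum>v\<in>V'. \<Sum>v)"
      using moved sum_shift_set_le(2)[OF fin(1,3) \<open>i < j\<close>]
        sum_shift_set_le(2)[OF fin(2,4) \<open>i < j\<close>] by metis
    then show False
      using le sum_shift_set_le(1)[OF fin(1,3) \<open>i < j\<close>] sum_shift_set_le(1)[OF fin(2,4) \<open>i < j\<close>]
      unfolding w_def prod.case by linarith
  qed
  have "shifted U'" "shifted V'"
    unfolding shifted_def using stable unfolding shift_set_def by (metis insertI1)+
  then show thesis using that UV by blast
qed

text \<open>If every prefix had room for both sets, repeated exchanges would turn \<open>u\<close>
  into a member of \<open>U\<close> disjoint from \<open>v\<close>. The induction is on the number
  of common points.\<close>

lemma shifted_cross_intersecting_prefix: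
  assumes "shifted U" "cross_intersecting U V" "u \<in> U" "v \<in> V" "finite u"
  shows "\<exists>j. j < card (u \<inter> {..<j}) + card (v \<inter> {..<j})"
proof (rule ccontr)
  assume "\<not> ?thesis"
  then have "\<forall>j. card (u \<inter> {..<j}) + card (v \<inter> {..<j}) \<le> j" by (simp add: not_less)
  with assms(3,5) show False
  proof (induction "card (u \<inter> v)" arbitrary: u rule: less_induct)
    case less
    \<comment> \<open>Move the least common element \<open>t\<close> to a smaller gap of \<open>u \<union> v\<close>. Below \<open>t\<close> the new pair is
      disjoint, so its prefix counts stay bounded there; above \<open>t\<close> they do not change.\<close>
    define t where "t = Min (u \<inter> v)"
    have "u \<inter> v \<noteq> {}" using assms(2,4) less.prems(1) by (auto simp: cross_intersecting_def)
    then have t: "t \<in> u" "t \<in> v" and t_min: "\<And>s. s \<in> u \<Longrightarrow> s \<in> v \<Longrightarrow> t \<le> s"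
      using Min_in[of "u \<inter> v"] less.prems(2) unfolding t_def by auto
    have card_Un: "card (x \<inter> {..<j}) + card (v \<inter> {..<j})
        = card ((x \<union> v) \<inter> {..<j}) + card (x \<inter> v \<inter> {..<j})" for x :: "nat set" and j
      using card_Un_Int[of "x \<inter> {..<j}" "v \<inter> {..<j}"] by (simp add: Int_Un_distrib2[symmetric] Int_ac)
    \<comment> \<open>Without such a gap the prefix of length \<open>Suc t\<close> would be covered
      completely with \<open>t\<close> counted twice, more than the prefix bound allows.\<close>
    obtain s where s: "s < t" "s \<notin> u" "s \<notin> v"
    proof (rule ccontr)
      assume "\<not> thesis"
      then have "(u \<union> v) \<inter> {..<Suc t} = {..<Suc t}"
        using that t by (fastforce simp: less_Suc_eq)
      moreover have "card (u \<inter> v \<inter> {..<Suc t}) > 0"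
        using t by (auto simp: card_gt_0_iff)
      ultimately show False
        using less.prems(3)[rule_format, of "Suc t"] card_Un[of u "Suc t"] by simp
    qed
    define u' where "u' = insert s (u - {t})"
    have "u' \<in> U" using assms(1) less.prems(1) s t unfolding shifted_def u'_def by blast
    moreover have "finite u'" using less.prems(2) by (simp add: u'_def)
    moreover have "u' \<inter> v \<subset> u \<inter> v" using s t by (auto simp: u'_def)
    then have "card (u' \<inter> v) < card (u \<inter> v)" using less.prems(2) by (simp add: psubset_card_mono)
    moreover have "card (u' \<inter> {..<j}) + card (v \<inter> {..<j}) \<le> j" for j
    proof (cases "j \<le> t")
      case True
      then have "u' \<inter> v \<inter> {..<j} = {}" using s t_min by (force simp: u'_def)
      then show ?thesis
        using card_Un[of u' j] card_mono[of "{..<j}" "(u' \<union> v) \<inter> {..<j}"] by simp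
    next
      case False
      then have "u' \<inter> {..<j} = insert s (u \<inter> {..<j} - {t})" using s by (auto simp: u'_def)
      moreover have "card (insert s (u \<inter> {..<j} - {t})) = card (u \<inter> {..<j})"
        using s t False by (intro card_insert_Diff_singleton) auto
      ultimately show ?thesis using less.prems(3) by simp
    qed
    ultimately show False using less.hyps by blast
  qed
qed

section \<open>Counting k-subsets that contain or meet given sets\<close>

lemma card_k_subsets_superset:
  assumes "finite X" "T \<subseteq> X"
  shows "card {u \<in> k_subsets X k. T \<subseteq> u} \<le> (card X - card T) choose (k - card T)"
proof -
  have "finite T" using assms finite_subset by blast
  have "inj_on (\<lambda>u. u - T) {u \<in> k_subsets X k. T \<subseteq> u}" by (rule inj_onI) blast
  \<comment> \<open>If \<open>T\<close> has more than \<open>k\<close> elements, the left side is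
    empty while truncated subtraction makes the right side \<open>{{}}\<close>; hence an upper bound
    and not an exact count.\<close>
  moreover have "(\<lambda>u. u - T) ` {u \<in> k_subsets X k. T \<subseteq> u} \<subseteq> k_subsets (X - T) (k - card T)"
    using \<open>finite T\<close> by (auto simp: card_Diff_subset)
  ultimately have "card {u \<in> k_subsets X k. T \<subseteq> u} \<le> card (k_subsets (X - T) (k - card T))"
    using assms by (intro card_inj_on_le[where f = "\<lambda>u. u - T"]) (auto intro: finite_k_subsets)
  also have "\<dots> = (card X - card T) choose (k - card T)"
    using assms \<open>finite T\<close> by (simp add: n_subsets card_Diff_subset)
  finally show ?thesis .
qed

text \<open>Union bound over the \<open>t\<close>-subsets of \<open>Y\<close> that such a set can
  contain; those not inside \<open>X\<close> contribute nothing.\<close>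

lemma card_k_subsets_meeting:
  assumes "finite X" "finite Y"
  shows "card {u \<in> k_subsets X k. t \<le> card (u \<inter> Y)}
    \<le> (card Y choose t) * ((card X - t) choose (k - t))"
proof -
  have "{u \<in> k_subsets X k. t \<le> card (u \<inter> Y)}
      \<subseteq> (\<Union>T\<in>k_subsets Y t. {u \<in> k_subsets X k. T \<subseteq> u})"
  proof
    fix u assume u: "u \<in> {u \<in> k_subsets X k. t \<le> card (u \<inter> Y)}"
    then obtain T where "T \<subseteq> u \<inter> Y" "card T = t"
      using obtain_subset_with_card_n by (metis (no_types, lifting) mem_Collect_eq)
    then show "u \<in> (\<Union>T\<in>k_subsets Y t. {u \<in> k_subsets X k. T \<subseteq> u})" using u by auto
  qed
  then have "card {u \<in> k_subsets X k. t \<le> card (u \<inter> Y)}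
      \<le> card (\<Union>T\<in>k_subsets Y t. {u \<in> k_subsets X k. T \<subseteq> u})"
    using assms by (intro card_mono) (auto intro: finite_k_subsets)
  also have "\<dots> \<le> (\<Sum>T\<in>k_subsets Y t. card {u \<in> k_subsets X k. T \<subseteq> u})"
    using assms by (intro card_UN_le finite_k_subsets)
  also have "\<dots> \<le> (\<Sum>T\<in>k_subsets Y t. (card X - t) choose (k - t))"
  proof (rule sum_mono)
    fix T assume T: "T \<in> k_subsets Y t"
    show "card {u \<in> k_subsets X k. T \<subseteq> u} \<le> (card X - t) choose (k - t)"
    proof (cases "T \<subseteq> X")
      case True
      then show ?thesis using card_k_subsets_superset[OF assms(1) True] T by simp
    next
      case False
      then have "{u \<in> k_subsets X k. T \<subseteq> u} = {}" by auto
      then show ?thesis by (simp only: card.empty)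
    qed
  qed
  also have "\<dots> = (card Y choose t) * ((card X - t) choose (k - t))"
    using assms by (simp add: n_subsets)
  finally show ?thesis .
qed

subsection \<open>Binomial estimates\<close>

text \<open>Lowering both entries by one divides the coefficient by
  \<open>(N - j) / (K - j)\<close>, a ratio that stays at least \<open>c\<close>.\<close>

lemma power_mult_binomial_diff_le:
  assumes "c * K \<le> N" "0 < c" "j \<le> K"
  shows "c ^ j * ((N - j) choose (K - j)) \<le> N choose K"
  using \<open>j \<le> K\<close>
proof (induction j)
  case (Suc j)
  have "K \<le> N" using assms(1,2) by (metis One_nat_def Suc_leI le_trans mult_le_mono1 nat_mult_1)
  obtain L where L: "K - j = Suc L" using Suc.prems by (metis Suc_diff_Suc Suc_le_lessD)
  obtain M where M: "N - j = Suc M" using Suc.prems \<open>K \<le> N\<close> by (metis Suc_diff_Suc Suc_le_lessD le_trans)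
  have "c * (K - j) \<le> N - j"
    using assms(1,2)
    by (simp add: diff_mult_distrib2)
      (metis One_nat_def Suc_leI diff_le_mono diff_le_mono2 le_trans mult_le_mono1 nat_mult_1)
  then have "(c * Suc L) * (M choose L) \<le> Suc M * (M choose L)"
    unfolding L M by (rule mult_le_mono1)
  also have "\<dots> = (Suc M choose Suc L) * Suc L" by (rule Suc_times_binomial_eq)
  finally have "c * (M choose L) \<le> Suc M choose Suc L"
    by (simp add: mult.assoc mult.left_commute del: binomial_Suc_Suc mult_Suc mult_Suc_right)
  then have "c ^ Suc j * (M choose L) \<le> c ^ j * (Suc M choose Suc L)"
    by (simp add: mult.assoc mult.left_commute del: binomial_Suc_Suc)
  also have "\<dots> \<le> N choose K" using Suc L M by simp
  finally show ?case using L M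
    by (metis diff_Suc_1 diff_Suc_eq_diff_pred diff_commute diff_diff_left plus_1_eq_Suc add.commute)
qed simp

text \<open>Equality holds at \<open>j = 0\<close>, and consecutive coefficients have ratio
  \<open>(2 * j + 4) * (2 * j + 3) / ((j + 1) * (j + 3))\<close>, which is at most 4.\<close>

lemma binomial_le_four_power: "(2 * j + 2) choose (j + 2) \<le> 4 ^ j"
proof (induction j)
  case (Suc j)
  let ?a = "(2 * j + 2) choose (j + 2)" and ?b = "(2 * j + 3) choose (j + 2)"
    and ?c = "(2 * j + 4) choose (j + 3)"
  have b: "(j + 1) * ?b = (2 * j + 3) * ?a"
    using binomial_absorb_comp[of "2 * j + 3" "j + 2"] by simp
  have c: "(j + 3) * ?c = (2 * j + 4) * ?b"
    using Suc_times_binomial_eq[of "2 * j + 3" "j + 2"] by (simp add: eval_nat_numeral mult.commute)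
  have "((j + 1) * (j + 3)) * ?c = ((2 * j + 4) * (2 * j + 3)) * ?a"
    using b c by (metis mult.assoc mult.left_commute)
  also have "\<dots> \<le> ((j + 1) * (j + 3)) * (4 * ?a)"
  proof -
    have "(2 * j + 4) * (2 * j + 3) \<le> ((j + 1) * (j + 3)) * 4" by (simp add: algebra_simps)
    from mult_le_mono1[OF this, of ?a] show ?thesis by (simp only: mult.assoc)
  qed
  finally have "?c \<le> 4 * ?a" by simp
  with Suc show ?case by (simp add: add.commute eval_nat_numeral)
qed simp

text \<open>The two preceding bounds, with \<open>c = 4 * k\<close>, make the \<open>j\<close>-th
  term at most \<open>(N choose K) / k ^ j\<close>; the geometric series contributes the factor
  \<open>k / (k - 1)\<close>.\<close>

lemma sum_binomial_products_le:
  assumes "2 \<le> k" "4 * k * K \<le> N"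
  shows "(k - 1) * (\<Sum>j<Suc K. ((2 * j + 2) choose (j + 2)) * ((N - j) choose (K - j)))
    \<le> k * (N choose K)"
proof -
  have le: "real (((2 * j + 2) choose (j + 2)) * ((N - j) choose (K - j)))
      \<le> real (N choose K) * (1 / real k) ^ j" if "j < Suc K" for j
  proof -
    have "k ^ j * (((2 * j + 2) choose (j + 2)) * ((N - j) choose (K - j)))
        \<le> k ^ j * (4 ^ j * ((N - j) choose (K - j)))"
      using binomial_le_four_power by (intro mult_le_mono) auto
    also have "\<dots> = (4 * k) ^ j * ((N - j) choose (K - j))" by (simp add: power_mult_distrib)
    also have "\<dots> \<le> N choose K"
      using assms that by (intro power_mult_binomial_diff_le) auto
    finally have "real (k ^ j * (((2 * j + 2) choose (j + 2)) * ((N - j) choose (K - j)))) \<le> real (N choose K)"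
      by (rule of_nat_mono)
    then show ?thesis using assms(1) by (simp add: field_simps)
  qed
  let ?S = "\<Sum>j<Suc K. ((2 * j + 2) choose (j + 2)) * ((N - j) choose (K - j))"
  have "real ?S \<le> (\<Sum>j<Suc K. real (N choose K) * (1 / real k) ^ j)"
    unfolding of_nat_sum by (intro sum_mono le) auto
  also have "\<dots> = real (N choose K) * (\<Sum>j<Suc K. (1 / real k) ^ j)" by (rule sum_distrib_left[symmetric])
  finally have "(1 - 1 / real k) * real ?S
      \<le> (1 - 1 / real k) * (real (N choose K) * (\<Sum>j<Suc K. (1 / real k) ^ j))"
    using assms(1) by (intro mult_left_mono) auto
  also have "\<dots> = real (N choose K) * (1 - (1 / real k) ^ Suc K)"
    by (simp only: one_diff_power_eq[of _ "Suc K"] mult_ac)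
  also have "\<dots> \<le> real (N choose K)" by (simp add: mult_left_le)
  finally have "(real k - 1) * real ?S \<le> real k * real (N choose K)"
    using assms(1) by (simp add: field_simps)
  then have "real ((k - 1) * ?S) \<le> real (k * (N choose K))"
    using assms(1) by (simp add: of_nat_diff)
  then show ?thesis by (simp only: of_nat_le_iff)
qed

subsection \<open>Sizes of cross-intersecting families\<close>

text \<open>Union bound over the point \<open>y\<close> of \<open>v\<close> that is met;
  \<open>x \<notin> v\<close> makes \<open>{x, y}\<close> a genuine pair.\<close>

lemma card_k_subsets_through_meeting:
  assumes "finite X" "finite v" "x \<notin> v"
  shows "card {u \<in> k_subsets X k. x \<in> u \<and> u \<inter> v \<noteq> {}} \<le> card v * ((card X - 2) choose (k - 2))"
proof -
  have "{u \<in> k_subsets X k. x \<in> u \<and> u \<inter> v \<noteq> {}} \<subseteq> (\<Union>y\<in>v. {u \<in> k_subsets X k. {x, y} \<subseteq> u})"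
    by auto
  then have "card {u \<in> k_subsets X k. x \<in> u \<and> u \<inter> v \<noteq> {}}
      \<le> card (\<Union>y\<in>v. {u \<in> k_subsets X k. {x, y} \<subseteq> u})"
    using assms by (intro card_mono) (auto intro: finite_k_subsets)
  also have "\<dots> \<le> (\<Sum>y\<in>v. card {u \<in> k_subsets X k. {x, y} \<subseteq> u})"
    using assms by (intro card_UN_le)
  also have "\<dots> \<le> (\<Sum>y\<in>v. (card X - 2) choose (k - 2))"
  proof (rule sum_mono)
    fix y assume "y \<in> v"
    then have "x \<noteq> y" using assms(3) by blast
    then have "card {x, y} = 2" by simp
    show "card {u \<in> k_subsets X k. {x, y} \<subseteq> u} \<le> (card X - 2) choose (k - 2)"
    proof (cases "{x, y} \<subseteq> X")
      case True
      then show ?thesis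
        using card_k_subsets_superset[OF assms(1) True, of k] \<open>card {x, y} = 2\<close> by simp
    next
      case False
      then have "{u \<in> k_subsets X k. {x, y} \<subseteq> u} = {}" by auto
      then show ?thesis by (simp only: card.empty)
    qed
  qed
  finally show ?thesis by simp
qed

text \<open>Too large a \<open>U\<close> contains a set that is sparse on every prefix. Every member
  of \<open>V\<close> must then be dense on some prefix, and such sets are too few for
  \<open>large\<close>.\<close>

lemma shifted_cross_intersecting_bound:
  assumes k: "2 \<le> k" "4 * k * (k - 1) + 2 \<le> m"
    and U: "U \<subseteq> k_subsets {..<m} k" and V: "V \<subseteq> k_subsets {..<m} (k - 1)"
    and cross: "cross_intersecting U V" and "shifted U"
    and large: "(m - 1) choose (k - 2) < card V"
  shows "(k - 1) * card U \<le> (k * (k - 1) + 1) * ((m - 2) choose (k - 2))"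
proof (rule ccontr)
  assume contr: "\<not> ?thesis"
  \<comment> \<open>Both union bounds have this form: \<open>K = k - 2\<close> for the sets
    \<open>bad j\<close>, and \<open>K = k - 3\<close> for the sets \<open>heavy j\<close> once
    \<open>k \<ge> 3\<close>.\<close>
  let ?S = "\<lambda>K. \<Sum>j<Suc K. ((2 * j + 2) choose (j + 2)) * ((m - 2 - j) choose (K - j))"
  have "\<exists>v\<in>V. 0 \<notin> v"
  proof (rule ccontr)
    assume "\<not> ?thesis"
    then have "V \<subseteq> {v \<in> k_subsets {..<m} (k - 1). {0} \<subseteq> v}" using V by auto
    then have "card V \<le> card {v \<in> k_subsets {..<m} (k - 1). {0} \<subseteq> v}"
      by (intro card_mono) (auto intro: finite_k_subsets)
    also have "\<dots> \<le> (m - 1) choose (k - 2)"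
      using card_k_subsets_superset[of "{..<m}" "{0}" "k - 1"] k by (simp add: numeral_2_eq_2)
    finally show False using large by simp
  qed
  then obtain v where v: "v \<in> V" "0 \<notin> v" by blast
  have "v \<subseteq> {..<m}" "card v = k - 1" using v V by auto
  then have "finite v" using finite_subset by blast
  define U0 where "U0 = {u \<in> k_subsets {..<m} k. 0 \<in> u \<and> u \<inter> v \<noteq> {}}"
  \<comment> \<open>A set avoiding \<open>0\<close> and all \<open>bad j\<close> has at most \<open>j div 2\<close> elements below \<open>j\<close>, which by
    \<open>shifted_cross_intersecting_prefix\<close> forces every member of \<open>V\<close> to be concentrated on some prefix.\<close>
  define bad where "bad j = {u \<in> k_subsets {..<m} k. j + 2 \<le> card (u \<inter> {1..<2 * j + 3})}" for j
  have finite_bad: "finite (bad j)" for j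
    unfolding bad_def by (rule finite_subset[OF _ finite_k_subsets[of "{..<m}" k]]) auto
  have "\<exists>u\<in>U. 0 \<notin> u \<and> (\<forall>j<Suc (k - 2). u \<notin> bad j)"
  proof (rule ccontr)
    assume none: "\<not> ?thesis"
    have "U \<subseteq> U0 \<union> (\<Union>j<Suc (k - 2). bad j)"
    proof
      fix u assume "u \<in> U"
      show "u \<in> U0 \<union> (\<Union>j<Suc (k - 2). bad j)"
      proof (cases "0 \<in> u")
        case True
        have "u \<inter> v \<noteq> {}" using cross \<open>u \<in> U\<close> v(1) by (simp add: cross_intersecting_def)
        then show ?thesis using True U \<open>u \<in> U\<close> by (auto simp: U0_def)
      next
        case False
        then show ?thesis using none \<open>u \<in> U\<close> by (metis UN_I UnCI lessThan_iff)
      qed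
    qed
    moreover have "finite U0"
      unfolding U0_def by (rule finite_subset[OF _ finite_k_subsets[of "{..<m}" k]]) auto
    ultimately have "card U \<le> card (U0 \<union> (\<Union>j<Suc (k - 2). bad j))"
      by (intro card_mono) (auto intro: finite_bad)
    also have "\<dots> \<le> card U0 + card (\<Union>j<Suc (k - 2). bad j)" by (rule card_Un_le)
    finally have U_le: "card U \<le> card U0 + card (\<Union>j<Suc (k - 2). bad j)" .
    have "card (\<Union>j<Suc (k - 2). bad j) \<le> (\<Sum>j<Suc (k - 2). card (bad j))"
      by (intro card_UN_le) auto
    also have "\<dots> \<le> ?S (k - 2)"
    proof (rule sum_mono)
      fix j
      show "card (bad j) \<le> ((2 * j + 2) choose (j + 2)) * ((m - 2 - j) choose (k - 2 - j))"
        unfolding bad_def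
        using card_k_subsets_meeting[of "{..<m}" "{1..<2 * j + 3}" k "j + 2"] by (simp add: add.commute)
    qed
    finally have "card (\<Union>j<Suc (k - 2). bad j) \<le> ?S (k - 2)" .
    from order.trans[OF U_le add_left_mono[OF this]]
    have "(k - 1) * card U \<le> (k - 1) * (card U0 + ?S (k - 2))" by (rule mult_le_mono2)
    also have "\<dots> = (k - 1) * card U0 + (k - 1) * ?S (k - 2)" by (rule add_mult_distrib2)
    \<comment> \<open>A member of \<open>U\<close> through \<open>0\<close> must meet one of the
      \<open>k - 1\<close> points of \<open>v\<close>; the \<open>bad\<close> sets cost the
      geometric factor. Together \<open>(k - 1)^2 + k = k * (k - 1) + 1\<close>.\<close>
    also have "\<dots> \<le> (k - 1) * ((k - 1) * ((m - 2) choose (k - 2))) + k * ((m - 2) choose (k - 2))"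
    proof (rule add_mono)
    show "(k - 1) * card U0 \<le> (k - 1) * ((k - 1) * ((m - 2) choose (k - 2)))"
      using card_k_subsets_through_meeting[of "{..<m}" v 0 k] \<open>finite v\<close> v \<open>card v = k - 1\<close>
      unfolding U0_def by simp
    show "(k - 1) * ?S (k - 2) \<le> k * ((m - 2) choose (k - 2))"
    proof (rule sum_binomial_products_le)
      have "4 * k * (k - 2) \<le> 4 * k * (k - 1)" by (intro mult_le_mono) auto
      then show "4 * k * (k - 2) \<le> m - 2" using k by linarith
    qed (use k in simp)
    qed
    also have "\<dots> = (k * (k - 1) + 1) * ((m - 2) choose (k - 2))"
    proof -
      obtain l where "k = Suc l" using k by (cases k) auto
      then show ?thesis by (simp add: algebra_simps)
    qed
    finally show False using contr by simp
  qed
  then obtain u where u: "u \<in> U" "0 \<notin> u" "\<And>j. j < Suc (k - 2) \<Longrightarrow> u \<notin> bad j" by blast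
  have "u \<subseteq> {..<m}" "card u = k" using u U by auto
  then have "finite u" using finite_subset by blast
  \<comment> \<open>Because \<open>0 \<notin> u\<close>, a prefix of length \<open>2 * i + 1\<close>
    with \<open>i > 0\<close> meets \<open>u\<close> only in the interval that defines
    \<open>bad (i - 1)\<close>.\<close>
  have u_odd: "card (u \<inter> {..<2 * i + 1}) \<le> i" for i
  proof (cases i)
    case 0
    then show ?thesis using u by (simp add: lessThan_Suc)
  next
    case (Suc j)
    have "u \<inter> {..<2 * i + 1} = u \<inter> {1..<2 * j + 3}"
      using u(2) Suc by (auto simp: not_less_eq_eq[symmetric]) (metis gr0I Suc_leI One_nat_def)
    moreover have "card (u \<inter> {1..<2 * j + 3}) \<le> j + 1"
    proof (cases "j < Suc (k - 2)")
      case True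
      then show ?thesis
        using u(3)[OF True] \<open>u \<subseteq> {..<m}\<close> \<open>card u = k\<close> unfolding bad_def by auto
    next
      \<comment> \<open>Here \<open>k \<le> j + 1\<close>, so the size of \<open>u\<close> alone
        suffices.\<close>
      case False
      then show ?thesis
        using card_mono[OF \<open>finite u\<close>, of "u \<inter> {1..<2 * j + 3}"] \<open>card u = k\<close> by simp
    qed
    ultimately show ?thesis using Suc by simp
  qed
  have u_prefix: "card (u \<inter> {..<j}) \<le> j div 2" for j
  proof -
    have "card (u \<inter> {..<j}) \<le> card (u \<inter> {..<2 * (j div 2) + 1})"
      by (intro card_mono) auto
    with u_odd[of "j div 2"] show ?thesis by linarith
  qed
  \<comment> \<open>As \<open>u\<close> fills at most half of every prefix, the other set fills more
    than half of some even prefix; one of length \<open>2 * j + 2\<close> then holds at least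
    \<open>j + 2\<close> of its points.\<close>
  define heavy where
    "heavy j = {v \<in> k_subsets {..<m} (k - 1). j + 2 \<le> card (v \<inter> {..<2 * j + 2})}" for j
  have finite_heavy: "finite (heavy j)" for j
    unfolding heavy_def by (rule finite_subset[OF _ finite_k_subsets[of "{..<m}" "k - 1"]]) auto
  have "V \<subseteq> (\<Union>j<k - 2. heavy j)"
  proof
    fix w assume "w \<in> V"
    then have w: "w \<subseteq> {..<m}" "card w = k - 1" using V by auto
    then have "finite w" using finite_subset by blast
    obtain j where "j < card (u \<inter> {..<j}) + card (w \<inter> {..<j})"
      using shifted_cross_intersecting_prefix[OF \<open>shifted U\<close> cross u(1) \<open>w \<in> V\<close> \<open>finite u\<close>] by blast
    then have j: "j < j div 2 + card (w \<inter> {..<j})" using u_prefix[of j] by linarith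
    define i where "i = j div 2"
    \<comment> \<open>For odd \<open>j\<close> the count exceeds \<open>i + 1\<close>, so dropping
      the last point of the prefix still leaves more than \<open>i\<close>.\<close>
    have i: "i < card (w \<inter> {..<2 * i})"
    proof (cases "even j")
      case True
      then have "j = 2 * i" by (simp add: i_def)
      then show ?thesis using j by simp
    next
      case False
      then have ji: "j = Suc (2 * i)" by (simp add: i_def)
      have "card (w \<inter> {..<j}) \<le> card (insert (2 * i) (w \<inter> {..<2 * i}))"
        unfolding ji by (intro card_mono) auto
      also have "\<dots> \<le> Suc (card (w \<inter> {..<2 * i}))" by (rule card_insert_le_m1) auto
      finally show ?thesis using j ji by simp
    qed
    then obtain l where l: "i = Suc l" by (cases i) auto
    have "card (w \<inter> {..<2 * i}) \<le> k - 1" using w card_mono[OF \<open>finite w\<close>] by (metis Int_lower1)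
    then have "l < k - 2" using i l by linarith
    moreover have "w \<in> heavy l" using w i l by (simp add: heavy_def)
    ultimately show "w \<in> (\<Union>j<k - 2. heavy j)" by blast
  qed
  then have "card V \<le> card (\<Union>j<k - 2. heavy j)"
    by (intro card_mono) (auto intro: finite_heavy)
  also have "\<dots> \<le> (\<Sum>j<k - 2. card (heavy j))" by (intro card_UN_le) auto
  also have "\<dots> \<le> (\<Sum>j<k - 2. ((2 * j + 2) choose (j + 2)) * ((m - 2 - j) choose (k - 3 - j)))"
  proof (rule sum_mono)
    fix j
    show "card (heavy j) \<le> ((2 * j + 2) choose (j + 2)) * ((m - 2 - j) choose (k - 3 - j))"
      unfolding heavy_def
      using card_k_subsets_meeting[of "{..<m}" "{..<2 * j + 2}" "k - 1" "j + 2"]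
      by (simp add: add.commute eval_nat_numeral)
  qed
  finally have V_le: "card V
      \<le> (\<Sum>j<k - 2. ((2 * j + 2) choose (j + 2)) * ((m - 2 - j) choose (k - 3 - j)))" .
  show False
  \<comment> \<open>For \<open>k = 2\<close> the sum is empty, and truncation would break
    \<open>k - 2 = Suc (k - 3)\<close>.\<close>
  proof (cases "k = 2")
    case True
    then show False using V_le large by simp
  next
    case False
    define K where "K = k - 3"
    have K: "k = K + 3" using False k by (simp add: K_def)
    have K': "k - 2 = Suc K" "k - 3 = K" using K by auto
    have mK: "4 * k * Suc K \<le> m - 2"
    proof -
      have "4 * k * Suc K \<le> 4 * k * (k - 1)" using K by (intro mult_le_mono) auto
      then show ?thesis using k by linarith
    qed
    have "4 * k * K \<le> m - 2" using mK by simp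
    then have "(k - 1) * ?S K \<le> k * ((m - 2) choose K)"
      using k by (intro sum_binomial_products_le) auto
    moreover have "card V \<le> ?S K" using V_le by (simp only: K')
    ultimately have "(k - 1) * card V \<le> k * ((m - 2) choose K)"
      by (meson le_trans mult_le_mono2)
    also have "\<dots> \<le> (k - 1) * (2 * ((m - 2) choose K))" by (simp add: K algebra_simps)
    finally have "card V \<le> 2 * ((m - 2) choose K)" using k by simp
    \<comment> \<open>Raising the lower index in one of the two copies, still within the increasing
      half of the row, prepares Pascal's rule.\<close>
    also have "\<dots> \<le> ((m - 2) choose K) + ((m - 2) choose Suc K)"
    proof -
      have "2 * Suc K \<le> 4 * k * Suc K" using k by (intro mult_le_mono1) linarith
      then have "(m - 2) choose K \<le> (m - 2) choose Suc K"
        using mK by (intro binomial_mono) auto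
      then show ?thesis by simp
    qed
    also have "\<dots> = (m - 1) choose (k - 2)"
    proof -
      have "m - 1 = Suc (m - 2)" "k - 2 = Suc K" using k K by auto
      then show ?thesis by simp
    qed
    finally show False using large by simp
  qed
qed

text \<open>Shifting needs an ordered ground set, so a bijection first carries \<open>X\<close> to
  an initial segment; sizes and cross-intersection survive both the relabelling and the
  shifting.\<close>

lemma cross_intersecting_bound:
  assumes "finite X" "2 \<le> k" "4 * k * (k - 1) + 2 \<le> card X"
    and U: "U \<subseteq> k_subsets X k" and V: "V \<subseteq> k_subsets X (k - 1)"
    and cross: "cross_intersecting U V"
    and large: "(card X - 1) choose (k - 2) < card V"
  shows "(k - 1) * card U \<le> (k * (k - 1) + 1) * ((card X - 2) choose (k - 2))"
proof -
  obtain f where "bij_betw f X {0..<card X}" using ex_bij_betw_finite_nat[OF assms(1)] by blast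
  then have f: "inj_on f X" "f ` X = {..<card X}" by (auto simp: bij_betw_def)
  have inj: "inj_on ((`) f) (Pow X)" using f(1) by (rule inj_on_image_Pow)
  have card_eq: "card ((`) f ` W) = card W" if "W \<subseteq> k_subsets X l" for W l
    using that by (intro card_image inj_on_subset[OF inj]) auto
  have sub: "(`) f ` W \<subseteq> k_subsets {..<card X} l" if "W \<subseteq> k_subsets X l" for W l
  proof
    fix v assume "v \<in> (`) f ` W"
    then obtain u where u: "u \<in> W" "v = f ` u" by blast
    then have "u \<subseteq> X" "card u = l" using that by auto
    then show "v \<in> k_subsets {..<card X} l"
      using u f image_mono[of u X f] card_image[OF inj_on_subset[OF f(1)], of u] by simp
  qed
  have "cross_intersecting ((`) f ` U) ((`) f ` V)"
    using cross unfolding cross_intersecting_def by blast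
  then obtain U' V' where "U' \<subseteq> k_subsets {..<card X} k" "V' \<subseteq> k_subsets {..<card X} (k - 1)"
    "cross_intersecting U' V'" "shifted U'"
    and "card U' = card ((`) f ` U)" "card V' = card ((`) f ` V)"
    by (rule ex_shifted_cross_intersecting[OF sub[OF U] sub[OF V]])
  then show ?thesis
    using shifted_cross_intersecting_bound[of k "card X" U' V'] assms(2,3) large card_eq[OF U] card_eq[OF V]
    by simp
qed

lemma card_le_sum_degrees:
  assumes "finite B" "finite a" "\<forall>b\<in>B. a \<inter> b \<noteq> {}"
  shows "card B \<le> (\<Sum>x\<in>a. card {b \<in> B. x \<in> b})"
proof -
  have "B \<subseteq> (\<Union>x\<in>a. {b \<in> B. x \<in> b})" using assms(3) by blast
  then have "card B \<le> card (\<Union>x\<in>a. {b \<in> B. x \<in> b})" using assms by (intro card_mono) auto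
  also have "\<dots> \<le> (\<Sum>x\<in>a. card {b \<in> B. x \<in> b})" using assms(2) by (rule card_UN_le)
  finally show ?thesis .
qed

text \<open>\<open>B_large\<close> is the balance condition with \<open>p\<close> eliminated: it
  combines a share of at least \<open>1 - p\<close> for \<open>B\<close> with the second lower bound
  on \<open>n\<close>.\<close>

lemma cross_intersecting_pair_bound:
  assumes "finite X" "2 \<le> k" "4 * k * (k - 1) + 3 \<le> card X"
    and A: "A \<subseteq> k_subsets X k" and B: "B \<subseteq> k_subsets X k"
    and "A \<inter> B = {}" and cross: "cross_intersecting A B"
    and "card B \<le> card A"
    and B_large: "(k\<^sup>2 - 1) * (card A + card B) \<le> (card X - 2) * card B"
  shows "card A + card B \<le> (card X - 1) choose (k - 1)"
proof (rule ccontr)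
  assume contr: "\<not> ?thesis"
  let ?n = "card X" and ?D = "(card X - 2) choose (k - 2)"
  have fin: "finite A" "finite B" "\<And>u. u \<in> A \<Longrightarrow> finite u" "\<And>u. u \<in> B \<Longrightarrow> finite u"
    using A B assms(1) finite_subset[OF A finite_k_subsets] finite_subset[OF B finite_k_subsets]
      finite_subset[of _ X] by auto
  \<comment> \<open>The size of a full star, expressed through \<open>?D\<close>, the number of
    \<open>k\<close>-subsets through two fixed points.\<close>
  have star: "(k - 1) * ((?n - 1) choose (k - 1)) = (?n - 1) * ?D"
  proof -
    have "?n - 1 = Suc (?n - 2)" "k - 1 = Suc (k - 2)" using assms(2,3) by auto
    then show ?thesis using Suc_times_binomial_eq[of "?n - 2" "k - 2"] by (metis mult.commute)
  qed
  have "0 < ?D"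
  proof -
    have "k * 1 \<le> k * (k - 1)" using assms(2) by (intro mult_le_mono) auto
    moreover have "4 * k * (k - 1) = 4 * (k * (k - 1))" by simp
    ultimately have "k \<le> card X" using assms(3) by linarith
    then show ?thesis by (intro zero_less_binomial) simp
  qed
  have total: "(?n - 1) * ?D < (k - 1) * (card A + card B)"
    using contr assms(2) unfolding star[symmetric] by simp
  \<comment> \<open>\<open>A\<close> holds at least half of all sets, and \<open>?n - 1\<close> is
    at least \<open>2 * (2 * k * (k - 1) + 1)\<close>.\<close>
  have A_large: "(2 * k * (k - 1) + 1) * ?D < (k - 1) * card A"
  proof -
    have "2 * ((2 * k * (k - 1) + 1) * ?D) = (4 * k * (k - 1) + 2) * ?D"
      by (simp add: add_mult_distrib add_mult_distrib2)
    also have "\<dots> \<le> (?n - 1) * ?D" using assms(3) by (intro mult_le_mono1) linarith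
    also have "\<dots> < (k - 1) * (card A + card B)" by (rule total)
    also have "\<dots> \<le> (k - 1) * (2 * card A)" using assms by (intro mult_le_mono2) simp
    finally show ?thesis by simp
  qed
  \<comment> \<open>In \<open>k\<^sup>2 - 1 = (k - 1) * (k + 1)\<close> the factor
    \<open>k - 1\<close> cancels against the one in \<open>total\<close>, leaving
    \<open>(k + 1) * ?D < card B\<close>.\<close>
  have B_gt: "k * ?D < card B"
  proof -
    obtain l where l: "k = Suc l" using assms(2) by (cases k) auto
    have "((?n - 2) * (l * (l + 2))) * ?D \<le> ((?n - 1) * (l * (l + 2))) * ?D"
      by (intro mult_le_mono) auto
    also have "\<dots> = (l * (l + 2)) * ((?n - 1) * ?D)" by (simp only: mult_ac)
    also have "\<dots> < (l * (l + 2)) * (l * (card A + card B))"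
      using total l assms(2) by simp
    also have "\<dots> = l * ((k\<^sup>2 - 1) * (card A + card B))"
      by (simp add: l power2_eq_square algebra_simps)
    also have "\<dots> \<le> l * ((?n - 2) * card B)" using B_large by (rule mult_le_mono2)
    finally have "(?n - 2) * l * ((l + 2) * ?D) < (?n - 2) * l * card B"
      by (simp only: mult_ac)
    then have "(l + 2) * ?D < card B" by simp
    then show ?thesis unfolding l by simp
  qed
  have meet: "a \<inter> b \<noteq> {}" if "a \<in> A" "b \<in> B" for a b
    using cross that by (auto simp: cross_intersecting_def)
  have not_star: "\<exists>b\<in>B. x \<notin> b" for x
  proof (rule ccontr)
    assume "\<not> ?thesis"
    then have all: "\<forall>b\<in>B. x \<in> b" by blast
    have "B \<noteq> {}" using B_gt by auto
    then have "x \<in> X" using all B by auto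
    show False
    proof (cases "\<forall>a\<in>A. x \<in> a")
      case True
      have "card A + card B = card (A \<union> B)"
        using fin assms(6) by (simp add: card_Un_disjoint)
      also have "\<dots> \<le> card {u \<in> k_subsets X k. {x} \<subseteq> u}"
        using True all A B assms(1) by (intro card_mono) auto
      also have "\<dots> \<le> (?n - 1) choose (k - 1)"
        using card_k_subsets_superset[OF assms(1), of "{x}" k] \<open>x \<in> X\<close> by simp
      finally show False using contr by simp
    next
      case False
      then obtain a where a: "a \<in> A" "x \<notin> a" by blast
      have "card a = k" using a A by auto
      have "B \<subseteq> {u \<in> k_subsets X k. x \<in> u \<and> u \<inter> a \<noteq> {}}"
        using all B meet[OF a(1)] by blast
      then have "card B \<le> card {u \<in> k_subsets X k. x \<in> u \<and> u \<inter> a \<noteq> {}}"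
        using assms(1) by (intro card_mono) simp_all
      also have "\<dots> \<le> k * ?D"
        using card_k_subsets_through_meeting[OF assms(1) fin(3)[OF a(1)] a(2), of k] \<open>card a = k\<close> by simp
      finally show False using B_gt by simp
    qed
  qed
  obtain a where a: "a \<in> A" using A_large by fastforce
  have "card a = k" "a \<subseteq> X" using a A by auto
  \<comment> \<open>The threshold \<open>?D\<close> is what \<open>large\<close> in
    \<open>cross_intersecting_bound\<close> asks for on the \<open>?n - 1\<close> points of
    \<open>X - {x}\<close>.\<close>
  have "\<exists>x\<in>a. ?D < card {b \<in> B. x \<in> b}"
  proof (rule ccontr)
    assume "\<not> ?thesis"
    then have "(\<Sum>x\<in>a. card {b \<in> B. x \<in> b}) \<le> card a * ?D"
      by (intro sum_bounded_above[where 'a = nat, simplified]) (auto simp: not_less)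
    moreover have "card B \<le> (\<Sum>x\<in>a. card {b \<in> B. x \<in> b})"
      using card_le_sum_degrees[OF fin(2) fin(3)[OF a]] meet[OF a] by blast
    ultimately show False using B_gt \<open>card a = k\<close> by simp
  qed
  then obtain x where x: "x \<in> a" "?D < card {b \<in> B. x \<in> b}" by blast
  obtain b where b: "b \<in> B" "x \<notin> b" using not_star by blast
  have "card b = k" using b B by auto
  \<comment> \<open>Members of \<open>U\<close> avoid \<open>x\<close>, so deleting \<open>x\<close>
    from sets of \<open>B\<close> destroys no intersection with them.\<close>
  define U where "U = {u \<in> A. x \<notin> u}"
  define V where "V = (\<lambda>v. v - {x}) ` {b \<in> B. x \<in> b}"
  have "card A \<le> card U + k * ?D"
  proof -
    have "card A \<le> card (U \<union> {u \<in> k_subsets X k. x \<in> u \<and> u \<inter> b \<noteq> {}})"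
      using A meet[OF _ b(1)] fin(1) assms(1) unfolding U_def by (intro card_mono) auto
    also have "\<dots> \<le> card U + card {u \<in> k_subsets X k. x \<in> u \<and> u \<inter> b \<noteq> {}}"
      by (rule card_Un_le)
    also have "card {u \<in> k_subsets X k. x \<in> u \<and> u \<inter> b \<noteq> {}} \<le> k * ?D"
      using card_k_subsets_through_meeting[OF assms(1) fin(4)[OF b(1)] b(2), of k] \<open>card b = k\<close> by simp
    finally show ?thesis by simp
  qed
  \<comment> \<open>Of the coefficient \<open>2 * k * (k - 1) + 1\<close> in \<open>A_large\<close>,
    the sets through \<open>x\<close> use up \<open>k * (k - 1)\<close>; the rest is the constant of
    \<open>cross_intersecting_bound\<close>.\<close>
  from mult_le_mono2[OF this, of "k - 1"]
  have "(k - 1) * card A \<le> (k - 1) * card U + k * (k - 1) * ?D"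
    by (simp only: add_mult_distrib2 mult_ac)
  moreover have "(2 * k * (k - 1) + 1) * ?D = k * (k - 1) * ?D + (k * (k - 1) + 1) * ?D"
    by (simp add: add_mult_distrib)
  ultimately have U_gt: "(k * (k - 1) + 1) * ?D < (k - 1) * card U" using A_large by linarith
  have card_X': "card (X - {x}) = ?n - 1" using x(1) \<open>a \<subseteq> X\<close> assms(1) by auto
  have "(k - 1) * card U \<le> (k * (k - 1) + 1) * ((card (X - {x}) - 2) choose (k - 2))"
  proof (rule cross_intersecting_bound[of _ _ _ V])
    show "finite (X - {x})" "2 \<le> k" using assms by auto
    show "4 * k * (k - 1) + 2 \<le> card (X - {x})" using assms(3) card_X' by simp
    show "U \<subseteq> k_subsets (X - {x}) k" using A by (auto simp: U_def)
    show "V \<subseteq> k_subsets (X - {x}) (k - 1)" using B fin(4) by (auto simp: V_def)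
    show "cross_intersecting U V"
      unfolding cross_intersecting_def U_def V_def using meet by fastforce
    have "inj_on (\<lambda>v. v - {x}) {b \<in> B. x \<in> b}" by (rule inj_onI) blast
    then have "card V = card {b \<in> B. x \<in> b}" unfolding V_def by (rule card_image)
    then show "(card (X - {x}) - 1) choose (k - 2) < card V" using x(2) card_X' by (simp add: numeral_2_eq_2)
  qed
  also have "\<dots> \<le> (k * (k - 1) + 1) * ?D"
    unfolding card_X' by (intro mult_le_mono2 binomial_right_mono) simp
  finally show False using U_gt by simp
qed

subsection \<open>Complete multipartite subgraphs\<close>

text \<open>A class with at least a third of the weight can stand alone. If there is none, a maximal
  subfamily of weight at most two thirds has at least one third, since otherwise another class would
  still fit. Its complement then also has at most two thirds.\<close>

lemma balanced_subset_exists: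
  fixes w :: "'a \<Rightarrow> real"
  assumes "finite P" "\<And>C. C \<in> P \<Longrightarrow> 0 \<le> w C" "\<And>C. C \<in> P \<Longrightarrow> w C \<le> p * sum w P" "2 / 3 \<le> p"
  shows "\<exists>Q\<subseteq>P. sum w Q \<le> p * sum w P \<and> sum w (P - Q) \<le> p * sum w P"
proof -
  have "0 \<le> sum w P" using assms(2) by (rule sum_nonneg)
  then have p: "2 / 3 * sum w P \<le> p * sum w P" using assms(4) by (intro mult_right_mono)
  have compl: "sum w (P - Q) = sum w P - sum w Q" if "Q \<subseteq> P" for Q
    using assms(1) that by (rule sum_diff)
  show ?thesis
  proof (cases "\<exists>C\<in>P. sum w P \<le> 3 * w C")
    case True
    then obtain C where "C \<in> P" "sum w P \<le> 3 * w C" by blast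
    then show ?thesis
      using compl[of "{C}"] assms(3) p by (intro exI[of _ "{C}"]) auto
  next
    case False
    let ?R = "{Q. Q \<subseteq> P \<and> 3 * sum w Q \<le> 2 * sum w P}"
    have "finite ?R" using assms(1) by simp
    moreover have "{} \<in> ?R" using \<open>0 \<le> sum w P\<close> by simp
    ultimately have "\<exists>Q\<in>?R. \<forall>Q'\<in>?R. Q \<subseteq> Q' \<longrightarrow> Q = Q'"
      by (intro finite_has_maximal) auto
    then obtain Q where Q: "Q \<in> ?R" and max: "\<forall>Q'\<in>?R. Q \<subseteq> Q' \<longrightarrow> Q = Q'"
      by (rule bexE)
    have "sum w P \<le> 3 * sum w Q"
    proof (rule ccontr)
      assume small: "\<not> ?thesis"
      then have "Q \<noteq> P" using \<open>0 \<le> sum w P\<close> by auto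
      then obtain C where C: "C \<in> P" "C \<notin> Q" using Q by blast
      have "finite Q" using Q assms(1) finite_subset by blast
      then have "sum w (insert C Q) = w C + sum w Q" using C by simp
      moreover have "3 * w C < sum w P" using False C by auto
      ultimately have "insert C Q \<in> ?R" using Q C small by auto
      then show False using max C by blast
    qed
    then show ?thesis using Q compl[of Q] p by (intro exI[of _ Q]) auto
  qed
qed

theorem theorem3:
  fixes k n :: nat and p :: real
    and H :: "nat set pair_pre_digraph" and P :: "nat set set set"
  assumes "k > 0"
    and "2 / 3 \<le> p" and "p < 1"
    and "real n \<ge> max (4 * (real k)^2 - 4 * real k + 3) (1 / (1 - p) * ((real k)^2 - 1) + 2)"
    and "subgraph H (graph_complement (kneser_graph n k))"
    and "complete_multipartite H P"
    and "\<forall>A\<in>P. real (card A) \<le> p * real (card (pverts H))"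
  shows "card (pverts H) \<le> (n - 1) choose (k - 1)"
proof (rule ccontr)
  assume contr: "\<not> ?thesis"
  let ?F = "pverts H"
  have F: "?F \<subseteq> k_subsets {1..n} k"
    and arcs: "parcs H \<subseteq> parcs (graph_complement (kneser_graph n k))"
    using assms(5) by (auto simp: subgraph_def graph_complement_def kneser_graph_def)
  have part: "partition_on ?F P"
    and adj: "\<And>A B u v. A \<in> P \<Longrightarrow> B \<in> P \<Longrightarrow> A \<noteq> B \<Longrightarrow> u \<in> A \<Longrightarrow> v \<in> B \<Longrightarrow> (u, v) \<in> parcs H"
    using assms(6) by (auto simp: complete_multipartite_def)
  have "finite ?F" using F finite_k_subsets[of "{1..n}" k] finite_subset by blast
  then have "finite P" using part by (rule finite_elements)
  have card_Union: "card (\<Union>Q) = sum card Q" if "Q \<subseteq> P" for Q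
  proof (rule card_Union_disjoint)
    show "disjoint Q" using partition_onD2[OF part] that by (rule pairwise_subset)
    show "finite C" if "C \<in> Q" for C
    proof (rule finite_subset[OF _ \<open>finite ?F\<close>])
      show "C \<subseteq> ?F" using that \<open>Q \<subseteq> P\<close> partition_onD1[OF part] by blast
    qed
  qed
  have total: "(\<Sum>C\<in>P. real (card C)) = real (card ?F)"
    using card_Union[of P] partition_onD1[OF part] by simp
  have "\<exists>Q\<subseteq>P. (\<Sum>C\<in>Q. real (card C)) \<le> p * (\<Sum>C\<in>P. real (card C)) \<and>
      (\<Sum>C\<in>P - Q. real (card C)) \<le> p * (\<Sum>C\<in>P. real (card C))"
    by (rule balanced_subset_exists) (use \<open>finite P\<close> assms(2,7) total in auto)
  then obtain Q where "Q \<subseteq> P" and Q: "real (card (\<Union>Q)) \<le> p * card ?F"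
      "real (card (\<Union>(P - Q))) \<le> p * card ?F"
    using card_Union unfolding total by (metis Diff_subset of_nat_sum)
  \<comment> \<open>Stated for an arbitrary \<open>R\<close>, so that either \<open>Q\<close> or
    \<open>P - Q\<close> can play the larger side.\<close>
  have impossible: False
    if R: "R \<subseteq> P" "real (card (\<Union>R)) \<le> p * card ?F" "card (\<Union>(P - R)) \<le> card (\<Union>R)"
      "real (card (\<Union>(P - R))) \<le> p * card ?F" for R
  proof -
    define A B where "A = \<Union>R" and "B = \<Union>(P - R)"
    have un: "A \<union> B = ?F" using R(1) partition_onD1[OF part] unfolding A_def B_def by blast
    have adjacent: "a \<noteq> b \<and> a \<inter> b \<noteq> {}" if "a \<in> A" "b \<in> B" for a b
    proof -
      have "(a, b) \<in> parcs H" using that R(1) adj unfolding A_def B_def by blast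
      then show ?thesis using arcs parcs_graph_complement_kneser_graph by blast
    qed
    then have "A \<inter> B = {}" by blast
    then have sum: "card A + card B = card ?F"
      using card_Un_disjoint[of A B] un \<open>finite ?F\<close> by (metis finite_Un)
    have k_sets: "A \<subseteq> k_subsets {1..n} k" "B \<subseteq> k_subsets {1..n} k" using un F by auto
    have "0 < card ?F" using contr by simp
    then have "p * card ?F < card ?F" using assms(3) by simp
    then have "card A < card ?F" "card B < card ?F" using R unfolding A_def B_def by linarith+
    then have "A \<noteq> {}" "B \<noteq> {}" using sum by auto
    have B_large: "(1 - p) * card ?F \<le> card B"
      using R(2) sum unfolding A_def by (simp add: algebra_simps flip: of_nat_add)
    show False
    \<comment> \<open>Intersecting singletons coincide, whereas vertices from the two sides are
      distinct; \<open>p < 1\<close> has made both sides nonempty.\<close>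
    proof (cases "k = 1")
      case True
      obtain a b where ab: "a \<in> A" "b \<in> B" using \<open>A \<noteq> {}\<close> \<open>B \<noteq> {}\<close> by blast
      then have "card a = 1" "card b = 1" using k_sets True by auto
      then show False using adjacent[OF ab] by (auto simp: card_1_singleton_iff)
    next
      case False
      then have k: "2 \<le> k" using assms(1) by simp
      have k_k: "real (4 * k * (k - 1) + 3) = 4 * (real k)\<^sup>2 - 4 * real k + 3"
        using k by (cases k) (auto simp: power2_eq_square algebra_simps)
      then have "real (4 * k * (k - 1) + 3) \<le> real n" using assms(4) by simp
      then have n: "4 * k * (k - 1) + 3 \<le> n" by (simp only: of_nat_le_iff)
      have "1 / (1 - p) * ((real k)\<^sup>2 - 1) \<le> real (n - 2)" using assms(4) n by simp
      then have "(real k)\<^sup>2 - 1 \<le> real (n - 2) * (1 - p)" using assms(3) by (simp add: field_simps)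
      then have "((real k)\<^sup>2 - 1) * card ?F \<le> (real (n - 2) * (1 - p)) * card ?F"
        by (rule mult_right_mono) simp
      also have "\<dots> \<le> real (n - 2) * card B"
        using mult_left_mono[OF B_large, of "real (n - 2)"] by (simp only: mult.assoc of_nat_0_le_iff)
      finally have "real ((k\<^sup>2 - 1) * card ?F) \<le> real ((n - 2) * card B)"
        using k by (simp add: of_nat_diff)
      then have "(k\<^sup>2 - 1) * (card A + card B) \<le> (card {1..n} - 2) * card B"
        unfolding sum by (simp only: of_nat_le_iff card_atLeastAtMost diff_Suc_1)
      then have "card A + card B \<le> (card {1..n} - 1) choose (k - 1)"
        using k n k_sets \<open>A \<inter> B = {}\<close> adjacent R(3) unfolding A_def[symmetric] B_def[symmetric]
        by (intro cross_intersecting_pair_bound) (auto simp: cross_intersecting_def)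
      then show False using contr sum by simp
    qed
  qed
  show False
  proof (cases "card (\<Union>(P - Q)) \<le> card (\<Union>Q)")
    case True
    then show False using impossible[of Q] \<open>Q \<subseteq> P\<close> Q by blast
  next
    case False
    moreover have "P - (P - Q) = Q" using \<open>Q \<subseteq> P\<close> by blast
    ultimately show False using impossible[of "P - Q"] Q by simp
  qed
qed

end
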